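(* Let $q>0$. For all initial states $(\rho^l,v^l),(\rho^r,v^r)\in\mathcal D$, let $(\tilde\rho_i,\tilde v_i)=\mathcal{RS}^q_i((\rho^l,v^l),(\rho^r,v^r))$ and $\tilde y_i=\tilde\rho_i\,(\tilde v_i+p(\tilde\rho_i))$ for $i=1,2$. Then $$\mathrm{Tot.Var.}(\tilde y_1)\ \ge\ \mathrm{Tot.Var.}(\tilde y_2),$$ where $\mathrm{Tot.Var.}$ is the total variation over $x\in\mathbb R$.
   Context: Pressure. $p\in C^2([0,+\infty);[0,+\infty))$ satisfies $p(0)=0$, $p'(\rho)>0$ for all $\rho>0$, and $\rho\mapsto\rho p(\rho)$ is strictly convex. System. $\mathcal D=\mathbb R^+\times\mathbb R^+$ with $\mathbb R^+=[0,+\infty)$; states are $(\rho,v)\in\mathcal D$. The Aw-Rascle system is $\partial_t\rho+\partial_x(\rho v)=0$, $\partial_t(\rho(v+p(\rho)))+\partial_x(\rho v(v+p(\rho)))=0$. Write $f_1(\rho,v)=\rho v$ and $\lambda_1(\rho,v)=v-\rho p'(\rho)$. Classical Riemann solver. For $(\rho^l,v^l),(\rho^r,v^r)\in\mathcal D$, $\mathcal{RS}((\rho^l,v^l),(\rho^r,v^r))$ is the function of $x\in\mathbb R$ (the unconstrained self-similar solution at time $t=1$ with left/right initial states separated at $x=0$) defined a.e. as follows, with $w^l=v^l+p(\rho^l)$. Let $I_2=\{\rho\ge0:\ v^l+p(\rho^l)-p(\rho)=v^r\}$; the intermediate state in cases (a) and (b) is $(\rho^m,v^m)$ with $\rho^m=\max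 I_2$, $v^m=v^r$. (a) If $v^r\le v^l$: it equals $(\rho^l,v^l)$ for $x<\sigma$, $(\rho^m,v^m)$ for $\sigma<x<v^r$, $(\rho^r,v^r)$ for $x>v^r$, where $\sigma=(\rho^mv^m-\rho^lv^l)/(\rho^m-\rho^l)$ if $\rho^m\ne\rho^l$; if $\rho^m=\rho^l$ it equals $(\rho^l,v^l)$ for $x<v^r$ and $(\rho^r,v^r)$ for $x>v^r$. (b) If $v^l<v^r\le w^l$: it equals $(\rho^l,v^l)$ for $x<\lambda_1(\rho^l,v^l)$; for $\lambda_1(\rho^l,v^l)\le x\le\lambda_1(\rho^m,v^m)$ it is the unique state $(\rho,\,w^l-p(\rho))$ with $\rho^m\le\rho\le\rho^l$ and $\lambda_1(\rho,w^l-p(\rho))=x$; $(\rho^m,v^m)$ for $\lambda_1(\rho^m,v^m)<x<v^r$; $(\rho^r,v^r)$ for $x>v^r$. (c) If $v^r>w^l$ (vacuum): it equals $(\rho^l,v^l)$ for $x<\lambda_1(\rho^l,v^l)$; for $\lambda_1(\rho^l,v^l)\le x\le w^l$ it is the state $(\rho,w^l-p(\rho))$ with $0\le\rho\le\rho^l$ and $\lambda_1=x$; $(0,x)$ for $w^l<x<v^r$; $(\rho^r,v^r)$ for $x>v^r$. $f_1(\mathcal{RS}(\cdot,\cdot)(0))$ denotes the common value of $f_1$ at the one-sided traces at $x=0$. Constrained solvers. Given $q>0$, let $I_1=\{\rho\ge0:\ \rho\,(v^l+p(\rho^l)-p(\rho))=q\}$ and, when $I_1\neq\emptyset$, $\hat\rho=\max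 I_1$, $\hat v=q/\hat\rho$, $\check\rho_1=\min I_1$, $\check v_1=q/\check\rho_1$. Let also $\check v_2=v^r$, $\check\rho_2=q/v^r$ (when $v^r>0$, which always holds when these are used below). For $i\in\{1,2\}$: if $f_1(\mathcal{RS}((\rho^l,v^l),(\rho^r,v^r))(0))\le q$, then $\mathcal{RS}^q_i((\rho^l,v^l),(\rho^r,v^r))=\mathcal{RS}((\rho^l,v^l),(\rho^r,v^r))$; otherwise $\mathcal{RS}^q_i((\rho^l,v^l),(\rho^r,v^r))(x)$ equals $\mathcal{RS}((\rho^l,v^l),(\hat\rho,\hat v))(x)$ for $x<0$ and $\mathcal{RS}((\check\rho_i,\check v_i),(\rho^r,v^r))(x)$ for $x>0$. Functions of $x$ are considered up to a.e. equality; the total variation is the essential one (that of a good representative).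
   Formalization: The formal theorem additionally assumes I_2 is nonempty whenever v^r ≤ v^l+p(ρ^l): for bounded pressures such as p(ρ)=ρ/(1+ρ), max I_2 may fail to exist in case (a), and then the Riemann solver is undefined. *)

theory Defs
  imports "HOL-Analysis.Analysis"
begin

text \<open>The pressure is a function on the half-line; its values at negative densities are
  irrelevant, so derivatives are taken within \<^term>\<open>{0..}\<close> (one-sided at \<open>0\<close>).\<close>

definition hderiv :: "(real \<Rightarrow> real) \<Rightarrow> real \<Rightarrow> real" where
  "hderiv g \<rho> = vector_derivative g (at \<rho> within {0..})"

definition C2_halfline :: "(real \<Rightarrow> real) \<Rightarrow> bool" where
  "C2_halfline g \<longleftrightarrow>
     g differentiable_on {0..} \<and> hderiv g differentiable_on {0..} \<and>
     continuous_on {0..} (hderiv (hderiv g))"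

definition strictly_convex_on :: "real set \<Rightarrow> (real \<Rightarrow> real) \<Rightarrow> bool" where
  "strictly_convex_on S g \<longleftrightarrow>
     convex S \<and>
     (\<forall>x\<in>S. \<forall>y\<in>S. \<forall>t. x \<noteq> y \<and> 0 < t \<and> t < 1 \<longrightarrow>
        g ((1 - t) * x + t * y) < (1 - t) * g x + t * g y)"

definition pressure :: "(real \<Rightarrow> real) \<Rightarrow> bool" where
  "pressure p \<longleftrightarrow>
     p \<in> {0..} \<rightarrow> {0..} \<and> C2_halfline p \<and> p 0 = 0 \<and> (\<forall>\<rho>>0. hderiv p \<rho> > 0) \<and>
     strictly_convex_on {0..} (\<lambda>\<rho>. \<rho> * p \<rho>)"

text \<open>A state is a pair \<open>(\<rho>, v)\<close> of density and velocity.\<close>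

definition states :: "(real \<times> real) set" where
  "states = {0..} \<times> {0..}"

definition flux1 :: "real \<times> real \<Rightarrow> real" where
  "flux1 u = fst u * snd u"

definition lam1 :: "(real \<Rightarrow> real) \<Rightarrow> real \<times> real \<Rightarrow> real" where
  "lam1 p u = snd u - fst u * hderiv p (fst u)"

definition I2 :: "(real \<Rightarrow> real) \<Rightarrow> real \<times> real \<Rightarrow> real \<Rightarrow> real set" where
  "I2 p ul vr = {\<rho>. \<rho> \<ge> 0 \<and> snd ul + p (fst ul) - p \<rho> = vr}"

definition max_of :: "real set \<Rightarrow> real" where
  "max_of A = (GREATEST \<rho>. \<rho> \<in> A)"

definition min_of :: "real set \<Rightarrow> real" where
  "min_of A = (LEAST \<rho>. \<rho> \<in> A)"

definition fan :: "(real \<Rightarrow> real) \<Rightarrow> real \<Rightarrow> real \<Rightarrow> real \<Rightarrow> real \<Rightarrow> real \<times> real" where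
  "fan p w a b x =
     (let \<rho> = (THE \<rho>. a \<le> \<rho> \<and> \<rho> \<le> b \<and> lam1 p (\<rho>, w - p \<rho>) = x) in (\<rho>, w - p \<rho>))"

text \<open>The solution at time \<open>1\<close>, as a function of \<open>x\<close>.  It is only determined almost everywhere;
  the values at the finitely many jump points are an arbitrary choice.  If \<open>vr \<le> vl + p \<rho>l\<close>
  and \<^term>\<open>I2 p (\<rho>l, vl) vr\<close> is empty (possible for a bounded pressure), the solver is
  undefined and the value below is meaningless.\<close>

fun RS :: "(real \<Rightarrow> real) \<Rightarrow> real \<times> real \<Rightarrow> real \<times> real \<Rightarrow> real \<Rightarrow> real \<times> real" where
  "RS p (\<rho>l, vl) (\<rho>r, vr) x =
    (let w = vl + p \<rho>l;
         \<rho>m = max_of (I2 p (\<rho>l, vl) vr);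
         vm = vr;
         \<sigma> = (\<rho>m * vm - \<rho>l * vl) / (\<rho>m - \<rho>l)
     in if vr \<le> vl then
          if \<rho>m \<noteq> \<rho>l then
            if x < \<sigma> then (\<rho>l, vl) else if x < vr then (\<rho>m, vm) else (\<rho>r, vr)
          else
            if x < vr then (\<rho>l, vl) else (\<rho>r, vr)
        else if vr \<le> w then
          if x < lam1 p (\<rho>l, vl) then (\<rho>l, vl)
          else if x \<le> lam1 p (\<rho>m, vm) then fan p w \<rho>m \<rho>l x
          else if x < vr then (\<rho>m, vm)
          else (\<rho>r, vr)
        else
          if x < lam1 p (\<rho>l, vl) then (\<rho>l, vl)
          else if x \<le> w then fan p w 0 \<rho>l x
          else if x < vr then (0, x)
          else (\<rho>r, vr))"

definition flux_at_0 :: "(real \<Rightarrow> real \<times> real) \<Rightarrow> real" where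
  "flux_at_0 u =
     (THE c. \<exists>a b. (u \<longlongrightarrow> a) (at_left 0) \<and> (u \<longlongrightarrow> b) (at_right 0) \<and>
                   flux1 a = c \<and> flux1 b = c)"

definition I1 :: "(real \<Rightarrow> real) \<Rightarrow> real \<Rightarrow> real \<times> real \<Rightarrow> real set" where
  "I1 p q ul = {\<rho>. \<rho> \<ge> 0 \<and> \<rho> * (snd ul + p (fst ul) - p \<rho>) = q}"

definition hat :: "(real \<Rightarrow> real) \<Rightarrow> real \<Rightarrow> real \<times> real \<Rightarrow> real \<times> real" where
  "hat p q ul = (let \<rho> = max_of (I1 p q ul) in (\<rho>, q / \<rho>))"

definition check1 :: "(real \<Rightarrow> real) \<Rightarrow> real \<Rightarrow> real \<times> real \<Rightarrow> real \<times> real" where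
  "check1 p q ul = (let \<rho> = min_of (I1 p q ul) in (\<rho>, q / \<rho>))"

definition check2 :: "real \<Rightarrow> real \<times> real \<Rightarrow> real \<times> real" where
  "check2 q ur = (q / snd ur, snd ur)"

definition constrained ::
  "(real \<Rightarrow> real) \<Rightarrow> real \<Rightarrow> real \<times> real \<Rightarrow> real \<times> real \<Rightarrow> real \<times> real \<Rightarrow> real \<Rightarrow> real \<times> real" where
  "constrained p q chk ul ur x =
     (if flux_at_0 (RS p ul ur) \<le> q then RS p ul ur x
      else if x < 0 then RS p ul (hat p q ul) x
      else RS p chk ur x)"

definition RSq1 ::
  "(real \<Rightarrow> real) \<Rightarrow> real \<Rightarrow> real \<times> real \<Rightarrow> real \<times> real \<Rightarrow> real \<Rightarrow> real \<times> real" where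
  "RSq1 p q ul ur = constrained p q (check1 p q ul) ul ur"

definition RSq2 ::
  "(real \<Rightarrow> real) \<Rightarrow> real \<Rightarrow> real \<times> real \<Rightarrow> real \<times> real \<Rightarrow> real \<Rightarrow> real \<times> real" where
  "RSq2 p q ul ur = constrained p q (check2 q ur) ul ur"

definition y_of :: "(real \<Rightarrow> real) \<Rightarrow> real \<times> real \<Rightarrow> real" where
  "y_of p u = fst u * (snd u + p (fst u))"

definition pointwise_variation :: "(real \<Rightarrow> real) \<Rightarrow> ennreal" where
  "pointwise_variation g =
     (SUP (n, t) \<in> (UNIV :: nat set) \<times> {t :: nat \<Rightarrow> real. mono t}.
        \<Sum>i<n. ennreal \<bar>g (t (Suc i)) - g (t i)\<bar>)"

text \<open>Essential variation: infimum over all representatives of the a.e. class.\<close>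

definition total_variation :: "(real \<Rightarrow> real) \<Rightarrow> ennreal" where
  "total_variation f =
     (INF g \<in> {g. AE x in lebesgue. g x = f x}. pointwise_variation g)"

end

theory Submission
  imports Defs
begin

text \<open>If the classical solution already satisfies the flux constraint, both solvers return it.
  Otherwise the two constrained solutions agree for \<open>x < 0\<close> and end in the right datum for
  \<open>x > vr\<close>.  In between, the second solution stays in the single state of velocity \<open>vr\<close> and
  flux \<open>q\<close>, whereas the first one leaves the state \<open>\<rho>1\<close> of smallest density and flux \<open>q\<close> on
  the wave curve of the left datum by a wave of the first family.  So the claim is a triangle
  inequality: it is enough that the value \<open>c\<close> of \<open>y\<close> in the intermediate state of the second
  solution lies between two values of \<open>y\<close> that the first solution takes on nondegenerate
  intervals in \<open>0 < x < vr\<close> (\<open>total_variation_le_of_detour\<close>).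

  Write \<open>w = vl + p \<rho>l\<close>, so that the curve of the first family through the left datum consists
  of the states \<open>(\<rho>, w - p \<rho>)\<close>.  Along it \<open>y = \<rho> * w\<close>, and the flux is a strictly concave
  function of \<open>\<rho>\<close> whose derivative is the characteristic speed.  Along the states of flux \<open>q\<close>
  one has \<open>y = q + \<rho> * p \<rho>\<close>, so there \<open>y\<close> increases with the density; it also increases with
  the density at fixed velocity.  Let \<open>v1 = w - p \<rho>1\<close>.

  If \<open>vr < v1\<close>, the first solution jumps by a shock from \<open>\<rho>1\<close> to the state \<open>\<rho>m\<close> with velocity
  \<open>vr\<close>.  Then \<open>\<rho>1 < q / vr\<close>, and \<open>q / vr \<le> \<rho>m\<close> provided that the flux \<open>\<rho>m * vr\<close> is at
  least \<open>q\<close>; by the two monotonicities \<open>c\<close> is between the values of \<open>y\<close> on both sides of the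
  shock (\<open>shock_detour\<close>).  If \<open>vr > v1\<close>, the first solution rarefies from \<open>\<rho>1\<close> towards a
  smaller density or the vacuum, and \<open>c\<close> is strictly between the values of \<open>y\<close> at both ends of the
  fan (\<open>rarefaction_detour\<close>).  If \<open>vr = v1\<close>, the two solutions coincide.

  The proviso \<open>q \<le> \<rho>m * vr\<close> comes from the violated constraint.  In every configuration the
  classical solution has at the origin a flux bounded by that of some state \<open>\<rho>0\<close> of the wave
  curve, with \<open>\<rho>m \<le> \<rho>0\<close> if there is a \<open>\<rho>m\<close> (\<open>flux_at_0_exceeds\<close>).  Hence the flux exceeds \<open>q\<close> at \<open>\<rho>0\<close>, equals
  \<open>q\<close> at \<open>\<rho>1\<close>, and is at least \<open>q\<close> at \<open>\<rho>m\<close> by concavity whenever \<open>\<rho>1 \<le> \<rho>m\<close>.  The same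
  \<open>\<rho>0\<close> shows that \<open>\<rho>1\<close> exists and has positive characteristic speed.\<close>

section \<open>Essential variation and detours\<close>

lemma AE_lebesgue_ex_in_interval:
  fixes a b :: real
  assumes "AE x in lebesgue. P x" and "a < b"
  shows "\<exists>x. a < x \<and> x < b \<and> P x"
proof (rule ccontr)
  assume none: "\<not> ?thesis"
  have "negligible {x. \<not> P x}"
    using assms(1) by (simp add: eventually_ae_filter_negligible) (meson negligible_subset)
  then have "negligible {a<..<b}"
    by (rule negligible_subset) (use none in auto)
  then have "{a<..<b} = {}"
    using open_not_negligible[of "{a<..<b}"] by auto
  then show False
    using assms(2) by (metis dense greaterThanLessThan_iff empty_iff)
qed

lemma sum_le_pointwise_variation:
  assumes "mono t"
  shows "ennreal (\<Sum>i<n. \<bar>g (t (Suc i)) - g (t i)\<bar>) \<le> pointwise_variation g"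
proof -
  have "(\<Sum>i<n. ennreal \<bar>g (t (Suc i)) - g (t i)\<bar>) \<le> pointwise_variation g"
    unfolding pointwise_variation_def
    by (rule SUP_upper2[where i = "(n, t)"]) (use assms in auto)
  then show ?thesis
    by (simp add: sum_ennreal)
qed

lemma pointwise_variation_ge_append:
  fixes g :: "real \<Rightarrow> real"
  assumes t: "mono t" and "t n \<le> x1" "x1 \<le> x2" "x2 \<le> x3"
  shows "ennreal ((\<Sum>i<n. \<bar>g (t (Suc i)) - g (t i)\<bar>)
           + \<bar>g x1 - g (t n)\<bar> + \<bar>g x2 - g x1\<bar> + \<bar>g x3 - g x2\<bar>) \<le> pointwise_variation g"
proof -
  define t' where "t' i = (if i \<le> n then t i else if i = n + 1 then x1 else if i = n + 2 then x2 else x3)"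
    for i
  have "mono t'"
    by (rule incseq_SucI) (use assms in \<open>auto simp: t'_def mono_def\<close>)
  then have "ennreal (\<Sum>i<Suc (Suc (Suc n)). \<bar>g (t' (Suc i)) - g (t' i)\<bar>) \<le> pointwise_variation g"
    by (rule sum_le_pointwise_variation)
  moreover have "(\<Sum>i<n. \<bar>g (t' (Suc i)) - g (t' i)\<bar>) = (\<Sum>i<n. \<bar>g (t (Suc i)) - g (t i)\<bar>)"
    by (rule sum.cong) (auto simp: t'_def)
  ultimately show ?thesis
    by (simp add: t'_def add.assoc)
qed

text \<open>The modified function replaces everything that \<open>g\<close> does on the right of \<open>0\<close> by a stay at
  \<open>c\<close> followed by a stay at \<open>d\<close>.  Since \<open>c\<close> lies between \<open>g x1\<close> and \<open>g x2\<close>, and \<open>g\<close> reaches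
  \<open>d\<close> at \<open>x3\<close>, going from any earlier value through \<open>c\<close> to \<open>d\<close> is not longer than going
  through \<open>g x1\<close>, \<open>g x2\<close> and \<open>g x3\<close>.\<close>

lemma pointwise_variation_shortcut:
  fixes g :: "real \<Rightarrow> real"
  assumes "0 \<le> x1" "x1 \<le> x2" "x2 \<le> x3" and "0 \<le> s"
    and c: "min (g x1) (g x2) \<le> c" "c \<le> max (g x1) (g x2)" and d: "g x3 = d"
  shows "pointwise_variation (\<lambda>x. if x < 0 then g x else if x < s then c else d)
           \<le> pointwise_variation g"
    (is "pointwise_variation ?h \<le> _")
proof -
  \<comment> \<open>The variation still to be spent after the point \<open>x\<close>; adding it makes the induction on the
    number of sample points work.\<close>
  define rest where
    "rest x = (if x < 0 then \<bar>?h x - c\<bar> + \<bar>c - d\<bar> else if x < s then \<bar>c - d\<bar> else 0)" for x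
  consider "g x1 \<le> c" "c \<le> g x2" | "g x2 \<le> c" "c \<le> g x1"
    using c by (fastforce simp: min_le_iff_disj le_max_iff_disj)
  then have detour: "\<bar>z - c\<bar> + \<bar>c - d\<bar> \<le> \<bar>g x1 - z\<bar> + \<bar>g x2 - g x1\<bar> + \<bar>g x3 - g x2\<bar>" for z
    by cases (use d in linarith)+
  have rest_step: "\<bar>?h y - ?h x\<bar> + rest y \<le> rest x" if "x \<le> y" "0 \<le> y" for x y
    using that \<open>0 \<le> s\<close> by (auto simp: rest_def)
  have main: "ennreal ((\<Sum>i<n. \<bar>?h (t (Suc i)) - ?h (t i)\<bar>) + rest (t n)) \<le> pointwise_variation g"
    if t: "mono t" for n t
  proof (induction n)
    \<comment> \<open>As long as all points are negative, the sums for \<open>g\<close> and its replacement agree, and the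
      points \<open>x1\<close>, \<open>x2\<close>, \<open>x3\<close> can be appended.\<close>
    have neg: "ennreal ((\<Sum>i<n. \<bar>?h (t (Suc i)) - ?h (t i)\<bar>) + rest (t n)) \<le> pointwise_variation g"
      if "t n < 0" for n
    proof -
      have "t i < 0" if "i \<le> n" for i
        using monoD[OF t that] \<open>t n < 0\<close> by simp
      then have "(\<Sum>i<n. \<bar>?h (t (Suc i)) - ?h (t i)\<bar>) = (\<Sum>i<n. \<bar>g (t (Suc i)) - g (t i)\<bar>)"
        by (intro sum.cong) auto
      then have "(\<Sum>i<n. \<bar>?h (t (Suc i)) - ?h (t i)\<bar>) + rest (t n)
          \<le> (\<Sum>i<n. \<bar>g (t (Suc i)) - g (t i)\<bar>)
           + \<bar>g x1 - g (t n)\<bar> + \<bar>g x2 - g x1\<bar> + \<bar>g x3 - g x2\<bar>"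
        using detour[of "g (t n)"] \<open>t n < 0\<close> by (simp add: rest_def)
      then show ?thesis
        using pointwise_variation_ge_append[OF t, of n x1 x2 x3 g] \<open>t n < 0\<close> assms(1-3)
        by (meson ennreal_leI le_less_trans less_imp_le order_trans)
    qed
    {
      case 0
      show ?case
      proof (cases "t 0 < 0")
        case True
        then show ?thesis by (rule neg)
      next
        case False
        have "\<bar>c - d\<bar> \<le> \<bar>g x2 - g x1\<bar> + \<bar>g x3 - g x2\<bar>"
          using detour[of "g x1"] by linarith
        with False have "rest (t 0) \<le> \<bar>g x2 - g x1\<bar> + \<bar>g x3 - g x2\<bar>"
          by (simp add: rest_def)
        moreover have "ennreal (\<bar>g x2 - g x1\<bar> + \<bar>g x3 - g x2\<bar>) \<le> pointwise_variation g"
          using pointwise_variation_ge_append[of "\<lambda>_. x1" 0 x1 x2 x3 g] assms(2,3)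
          by (simp add: mono_def)
        ultimately show ?thesis
          by (metis (no_types, lifting) add_0 ennreal_leI lessThan_0 order_trans sum.empty)
      qed
    next
      case (Suc n)
      show ?case
      proof (cases "t (Suc n) < 0")
        case True
        then show ?thesis by (rule neg)
      next
        case False
        have "(\<Sum>i<Suc n. \<bar>?h (t (Suc i)) - ?h (t i)\<bar>) + rest (t (Suc n))
            = (\<Sum>i<n. \<bar>?h (t (Suc i)) - ?h (t i)\<bar>)
              + (\<bar>?h (t (Suc n)) - ?h (t n)\<bar> + rest (t (Suc n)))"
          by (simp add: add.assoc)
        also have "\<dots> \<le> (\<Sum>i<n. \<bar>?h (t (Suc i)) - ?h (t i)\<bar>) + rest (t n)"
          using rest_step[of "t n" "t (Suc n)"] monoD[OF t, of n "Suc n"] False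
          by (intro add_left_mono) auto
        finally show ?thesis
          using Suc.IH by (meson ennreal_leI order_trans)
      qed
    }
  qed
  have "(\<Sum>i<n. ennreal \<bar>?h (t (Suc i)) - ?h (t i)\<bar>) \<le> pointwise_variation g" if "mono t" for n t
  proof -
    have "0 \<le> rest (t n)"
      by (simp add: rest_def)
    then have "(\<Sum>i<n. \<bar>?h (t (Suc i)) - ?h (t i)\<bar>)
        \<le> (\<Sum>i<n. \<bar>?h (t (Suc i)) - ?h (t i)\<bar>) + rest (t n)"
      by linarith
    from order_trans[OF ennreal_leI[OF this] main[OF that]]
    show ?thesis
      by (subst sum_ennreal) auto
  qed
  then show ?thesis
    unfolding pointwise_variation_def[of ?h] by (intro SUP_least) auto
qed

text \<open>The passage from the pointwise to the essential variation: any representative of \<open>f\<close> agrees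
  with \<open>f\<close> at some point of each of the intervals, and altering it as in
  \<open>pointwise_variation_shortcut\<close> gives a representative of \<open>g\<close>.  The hypothesis \<open>between\<close>
  has to hold on intervals, since values of \<open>f\<close> at single points are not visible to the essential
  variation.\<close>

lemma total_variation_le_of_detour:
  fixes f g :: "real \<Rightarrow> real"
  assumes left: "\<And>x. x < 0 \<Longrightarrow> g x = f x"
    and mid: "\<And>x. 0 \<le> x \<Longrightarrow> x < s \<Longrightarrow> g x = c" and right: "\<And>x. s \<le> x \<Longrightarrow> g x = d"
    and f_end: "\<And>x. s < x \<Longrightarrow> f x = d"
    and ord: "0 \<le> \<alpha>" "\<alpha> < \<beta>" "\<beta> \<le> \<gamma>" "\<gamma> < \<delta>" "\<delta> \<le> s"
    and between: "\<And>x x'. \<alpha> < x \<Longrightarrow> x < \<beta> \<Longrightarrow> \<gamma> < x' \<Longrightarrow> x' < \<delta> \<Longrightarrow>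
                    min (f x) (f x') \<le> c \<and> c \<le> max (f x) (f x')"
  shows "total_variation g \<le> total_variation f"
  unfolding total_variation_def[of f]
proof (rule INF_greatest)
  fix f' assume "f' \<in> {f'. AE x in lebesgue. f' x = f x}"
  then have f': "AE x in lebesgue. f' x = f x" by simp
  obtain x1 where x1: "\<alpha> < x1" "x1 < \<beta>" "f' x1 = f x1"
    using AE_lebesgue_ex_in_interval[OF f' ord(2)] by auto
  obtain x2 where x2: "\<gamma> < x2" "x2 < \<delta>" "f' x2 = f x2"
    using AE_lebesgue_ex_in_interval[OF f' ord(4)] by auto
  obtain x3 where x3: "s < x3" "f' x3 = f x3"
    using AE_lebesgue_ex_in_interval[OF f', of s "s + 1"] by auto
  let ?g' = "\<lambda>x. if x < 0 then f' x else if x < s then c else d"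
  have "AE x in lebesgue. ?g' x = g x"
    using f' by eventually_elim (use left mid right in auto)
  then have "total_variation g \<le> pointwise_variation ?g'"
    unfolding total_variation_def by (intro INF_lower) simp
  also have "\<dots> \<le> pointwise_variation f'"
    using between[OF x1(1,2) x2(1,2)] f_end[OF x3(1)] ord x1 x2 x3
    by (intro pointwise_variation_shortcut[of x1 x2 x3]) auto
  finally show "total_variation g \<le> pointwise_variation f'" .
qed

section \<open>The first characteristic family\<close>

text \<open>The states of the first family with Lagrangian marker \<open>w\<close> are \<open>(\<rho>, w - p \<rho>)\<close>.  The two
  functions below are the flux and the characteristic speed along this curve; the second is the
  derivative of the first.\<close>

definition wave_flux :: "(real \<Rightarrow> real) \<Rightarrow> real \<Rightarrow> real \<Rightarrow> real" where
  "wave_flux p w \<rho> = \<rho> * (w - p \<rho>)"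

definition wave_speed :: "(real \<Rightarrow> real) \<Rightarrow> real \<Rightarrow> real \<Rightarrow> real" where
  "wave_speed p w \<rho> = w - p \<rho> - \<rho> * hderiv p \<rho>"

lemma lam1_eq_wave_speed: "lam1 p (\<rho>, w - p \<rho>) = wave_speed p w \<rho>"
  by (simp add: lam1_def wave_speed_def)

locale aw_rascle_pressure =
  fixes p :: "real \<Rightarrow> real"
  assumes pressure: "pressure p"
begin

lemma p_zero: "p 0 = 0"
  and p_nonneg: "0 \<le> \<rho> \<Longrightarrow> 0 \<le> p \<rho>"
  and hderiv_pos: "0 < \<rho> \<Longrightarrow> 0 < hderiv p \<rho>"
  using pressure by (auto simp: pressure_def)

lemma has_derivative_at_positive:
  assumes "0 < \<rho>"
  shows "(p has_real_derivative hderiv p \<rho>) (at \<rho>)"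
proof -
  have "p differentiable (at \<rho> within {0..})"
    using pressure assms by (auto simp: pressure_def C2_halfline_def differentiable_on_def)
  then have "(p has_vector_derivative hderiv p \<rho>) (at \<rho> within {0..})"
    unfolding hderiv_def by (rule vector_derivative_works[THEN iffD1])
  moreover have "at \<rho> within {0..} = at \<rho>"
    by (rule at_within_interior) (use assms in auto)
  ultimately show ?thesis
    by (simp add: has_real_derivative_iff_has_vector_derivative)
qed

lemma continuous_on_p: "continuous_on {0..} p"
  and continuous_on_hderiv: "continuous_on {0..} (hderiv p)"
  using pressure
  by (auto simp: pressure_def C2_halfline_def intro: differentiable_imp_continuous_on)

lemma continuous_on_wave_speed: "continuous_on {0..} (wave_speed p w)"
  unfolding wave_speed_def
  by (intro continuous_intros continuous_on_p continuous_on_hderiv)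

lemma continuous_on_wave_flux: "continuous_on {0..} (wave_flux p w)"
  unfolding wave_flux_def
  by (intro continuous_intros continuous_on_p)

lemma p_strict_mono:
  assumes "0 \<le> a" "a < b"
  shows "p a < p b"
proof (rule DERIV_pos_imp_increasing_open[OF \<open>a < b\<close>])
  show "\<exists>y. (p has_real_derivative y) (at x) \<and> 0 < y" if "a < x" for x
    using has_derivative_at_positive[of x] hderiv_pos[of x] that assms by auto
  show "continuous_on {a..b} p"
    by (rule continuous_on_subset[OF continuous_on_p]) (use assms in auto)
qed

lemma p_le_iff: "0 \<le> a \<Longrightarrow> 0 \<le> b \<Longrightarrow> p a \<le> p b \<longleftrightarrow> a \<le> b"
  using p_strict_mono[of a b] p_strict_mono[of b a] by (cases a b rule: linorder_cases) auto

lemma p_less_iff: "0 \<le> a \<Longrightarrow> 0 \<le> b \<Longrightarrow> p a < p b \<longleftrightarrow> a < b"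
  using p_strict_mono[of a b] p_strict_mono[of b a] by (cases a b rule: linorder_cases) auto

lemma p_eq_iff: "0 \<le> a \<Longrightarrow> 0 \<le> b \<Longrightarrow> p a = p b \<longleftrightarrow> a = b"
  using p_strict_mono[of a b] p_strict_mono[of b a] by (cases a b rule: linorder_cases) auto

lemma mass_pressure_strict_convex:
  assumes "0 \<le> a" "0 \<le> b" "a \<noteq> b" "0 < t" "t < 1"
  shows "((1 - t) * a + t * b) * p ((1 - t) * a + t * b) < (1 - t) * (a * p a) + t * (b * p b)"
  using pressure assms unfolding pressure_def strictly_convex_on_def by simp

lemma wave_flux_midpoint:
  assumes "0 \<le> a" "0 \<le> b" "a \<noteq> b"
  shows "wave_flux p w a + wave_flux p w b < 2 * wave_flux p w ((a + b) / 2)"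
proof -
  have "((1 - 1/2) * a + 1/2 * b) * p ((1 - 1/2) * a + 1/2 * b)
      < (1 - 1/2) * (a * p a) + 1/2 * (b * p b)"
    using mass_pressure_strict_convex[OF assms, of "1/2"] by simp
  moreover have "(1 - 1/2) * a + 1/2 * b = (a + b) / 2"
    by (simp add: field_simps)
  ultimately show ?thesis
    unfolding wave_flux_def right_diff_distrib by (auto simp: field_simps)
qed

text \<open>Concavity of the flux in differential form.  The point of tangency is positive because the
  criterion for convex functions needs an interior point of the half-line.\<close>

lemma wave_flux_below_tangent:
  assumes "0 < a" "0 \<le> b"
  shows "wave_flux p w b \<le> wave_flux p w a + wave_speed p w a * (b - a)"
proof -
  let ?h = "\<lambda>\<rho>. \<rho> * p \<rho>"
  have "convex_on {0..} ?h"
  proof (rule convex_onI)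
    fix t x y :: real assume "0 < t" "t < 1" "x \<in> {0..}" "y \<in> {0..}"
    then show "?h ((1 - t) *\<^sub>R x + t *\<^sub>R y) \<le> (1 - t) * ?h x + t * ?h y"
      using mass_pressure_strict_convex[of x y t]
      by (cases "x = y") (auto simp: less_imp_le left_diff_distrib)
  qed simp
  moreover have "(?h has_real_derivative p a + a * hderiv p a) (at a)"
    by (auto intro!: derivative_eq_intros has_derivative_at_positive assms)
  then have "(?h has_real_derivative p a + a * hderiv p a) (at a within {0..})"
    by (rule has_field_derivative_at_within)
  ultimately have "(p a + a * hderiv p a) * (b - a) \<le> ?h b - ?h a"
    using assms by (intro convex_on_imp_above_tangent[where A = "{0..}"]) auto
  then show ?thesis
    by (simp add: wave_flux_def wave_speed_def algebra_simps)
qed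

text \<open>Strictness comes from comparing the tangents at \<open>a\<close> and \<open>b\<close> at the midpoint, where strict
  concavity leaves room.  At \<open>a = 0\<close>, which the tangent inequality leaves out, the formula
  for the speed gives the inequality directly.\<close>

lemma wave_speed_strict_antimono:
  assumes "0 \<le> a" "a < b"
  shows "wave_speed p w b < wave_speed p w a"
proof (cases "a = 0")
  case True
  have "0 < b * hderiv p b"
    using assms hderiv_pos[of b] by (intro mult_pos_pos) auto
  with True assms p_nonneg[of b] show ?thesis
    by (simp add: wave_speed_def p_zero)
next
  case False
  define m where "m = (a + b) / 2"
  have "wave_flux p w a + wave_flux p w b < 2 * wave_flux p w m"
    using wave_flux_midpoint[of a b w] assms by (simp add: m_def)
  moreover have "wave_flux p w m \<le> wave_flux p w a + wave_speed p w a * (m - a)"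
    using assms False by (intro wave_flux_below_tangent) (auto simp: m_def)
  moreover have "wave_flux p w m \<le> wave_flux p w b + wave_speed p w b * (m - b)"
    using assms False by (intro wave_flux_below_tangent) (auto simp: m_def)
  ultimately have "0 < wave_speed p w a * (m - a) + wave_speed p w b * (m - b)"
    by linarith
  also have "\<dots> = (wave_speed p w a - wave_speed p w b) * ((b - a) / 2)"
  proof -
    have m: "m - a = (b - a) / 2" "m - b = - ((b - a) / 2)"
      by (simp_all add: m_def field_simps)
    show ?thesis
      unfolding m left_diff_distrib by simp
  qed
  finally have "0 < wave_speed p w a - wave_speed p w b"
    by (rule zero_less_mult_pos2) (use assms in simp)
  then show ?thesis
    by simp
qed

lemma wave_speed_le_iff:
  "0 \<le> a \<Longrightarrow> 0 \<le> b \<Longrightarrow> wave_speed p w a \<le> wave_speed p w b \<longleftrightarrow> b \<le> a"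
  using wave_speed_strict_antimono[of a b w] wave_speed_strict_antimono[of b a w]
  by (cases a b rule: linorder_cases) auto

lemma wave_speed_eq_iff:
  "0 \<le> a \<Longrightarrow> 0 \<le> b \<Longrightarrow> wave_speed p w a = wave_speed p w b \<longleftrightarrow> a = b"
  using wave_speed_strict_antimono[of a b w] wave_speed_strict_antimono[of b a w]
  by (cases a b rule: linorder_cases) auto

lemma wave_flux_ge_between:
  assumes "0 < m" "0 \<le> a" "a \<le> m" "m \<le> b" "q \<le> wave_flux p w a" "q \<le> wave_flux p w b"
  shows "q \<le> wave_flux p w m"
proof (rule ccontr)
  assume "\<not> ?thesis"
  then have "0 < wave_speed p w m * (a - m)" "0 < wave_speed p w m * (b - m)"
    using wave_flux_below_tangent[of m a w] wave_flux_below_tangent[of m b w] assms by auto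
  then show False
    using assms by (auto simp: zero_less_mult_iff)
qed

lemma max_of_I2_eq:
  assumes "\<rho> \<in> I2 p u v"
  shows "max_of (I2 p u v) = \<rho>"
  unfolding max_of_def
proof (rule Greatest_equality)
  show "\<rho>' \<le> \<rho>" if "\<rho>' \<in> I2 p u v" for \<rho>'
  proof -
    have "p \<rho>' = p \<rho>" and "0 \<le> \<rho>'" "0 \<le> \<rho>"
      using that assms by (simp_all add: I2_def)
    then show ?thesis
      by (simp add: p_eq_iff)
  qed
qed (rule assms)

lemma fan_wave_speed:
  assumes "0 \<le> a" "a \<le> \<rho>" "\<rho> \<le> b"
  shows "fan p w a b (wave_speed p w \<rho>) = (\<rho>, w - p \<rho>)"
proof -
  have "(THE \<rho>'. a \<le> \<rho>' \<and> \<rho>' \<le> b \<and> wave_speed p w \<rho>' = wave_speed p w \<rho>) = \<rho>"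
  proof (rule the_equality)
    show "\<rho>' = \<rho>" if "a \<le> \<rho>' \<and> \<rho>' \<le> b \<and> wave_speed p w \<rho>' = wave_speed p w \<rho>" for \<rho>'
      using that assms wave_speed_eq_iff[of \<rho>' \<rho> w] by simp
  qed (use assms in simp)
  then show ?thesis
    by (simp add: fan_def lam1_eq_wave_speed)
qed

lemma wave_speed_surj:
  assumes "0 \<le> a" "a \<le> b" "wave_speed p w b \<le> x" "x \<le> wave_speed p w a"
  obtains \<rho> where "a \<le> \<rho>" "\<rho> \<le> b" "wave_speed p w \<rho> = x"
proof -
  have "continuous_on {a..b} (wave_speed p w)"
    by (rule continuous_on_subset[OF continuous_on_wave_speed]) (use assms in auto)
  from IVT2'[OF assms(3,4,2) this] show ?thesis
    using that by blast
qed

text \<open>The fan inverts a continuous injective function on a compact interval.\<close>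

lemma continuous_on_fan:
  assumes "0 \<le> a" "a \<le> b"
  shows "continuous_on {wave_speed p w b..wave_speed p w a} (fan p w a b)"
proof -
  let ?J = "{wave_speed p w b..wave_speed p w a}"
  have image: "x \<in> wave_speed p w ` {a..b}" if "x \<in> ?J" for x
  proof -
    obtain \<rho> where "a \<le> \<rho>" "\<rho> \<le> b" "wave_speed p w \<rho> = x"
      by (rule wave_speed_surj[OF assms, of w x]) (use \<open>x \<in> ?J\<close> in auto)
    then show ?thesis by auto
  qed
  have inverse: "fst (fan p w a b (wave_speed p w \<rho>)) = \<rho>" if "\<rho> \<in> {a..b}" for \<rho>
    using fan_wave_speed[of a \<rho> b w] assms that by simp
  have "continuous_on {a..b} (wave_speed p w)"
    by (rule continuous_on_subset[OF continuous_on_wave_speed]) (use assms in auto)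
  then have "continuous_on (wave_speed p w ` {a..b}) (\<lambda>x. fst (fan p w a b x))"
    by (rule continuous_on_inv) (use inverse in auto)
  then have dens: "continuous_on ?J (\<lambda>x. fst (fan p w a b x))"
    by (rule continuous_on_subset) (use image in blast)
  have "(\<lambda>x. fst (fan p w a b x)) ` ?J \<subseteq> {0..}"
  proof
    fix \<rho> assume "\<rho> \<in> (\<lambda>x. fst (fan p w a b x)) ` ?J"
    then obtain x where "x \<in> ?J" and \<rho>: "\<rho> = fst (fan p w a b x)" by blast
    from image[OF this(1)] obtain \<rho>' where "\<rho>' \<in> {a..b}" "x = wave_speed p w \<rho>'" by blast
    then show "\<rho> \<in> {0..}"
      using inverse[of \<rho>'] assms \<rho> by simp
  qed
  then have press: "continuous_on ?J (\<lambda>x. p (fst (fan p w a b x)))"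
    by (rule continuous_on_compose2[OF continuous_on_p dens])
  have fan_eq: "(\<lambda>x. (fst (fan p w a b x), w - p (fst (fan p w a b x)))) = fan p w a b"
    by (simp add: fan_def Let_def fun_eq_iff)
  have "continuous_on ?J (\<lambda>x. (fst (fan p w a b x), w - p (fst (fan p w a b x))))"
    by (intro continuous_intros dens press)
  then show ?thesis
    unfolding fan_eq .
qed

end

section \<open>The trace of the Riemann solver at the constraint\<close>

text \<open>Existence of both traces matters: without it the description of the flux at the origin
  determines no number.\<close>

lemma flux_at_0_eq:
  assumes "(u \<longlongrightarrow> a) (at_left 0)" "(u \<longlongrightarrow> b) (at_right 0)" "flux1 a = c" "flux1 b = c"
  shows "flux_at_0 u = c"
  unfolding flux_at_0_def
proof (rule the_equality)
  show "\<exists>a b. (u \<longlongrightarrow> a) (at_left 0) \<and> (u \<longlongrightarrow> b) (at_right 0) \<and> flux1 a = c \<and> flux1 b = c"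
    using assms by blast
  show "c' = c"
    if "\<exists>a b. (u \<longlongrightarrow> a) (at_left 0) \<and> (u \<longlongrightarrow> b) (at_right 0) \<and> flux1 a = c' \<and> flux1 b = c'" for c'
    using that assms(1,3) tendsto_unique[of "at_left 0" u] by (metis trivial_limit_at_left_real)
qed

lemma flux_at_0_jump:
  assumes "0 < e" and "\<And>x. - e < x \<Longrightarrow> x < 0 \<Longrightarrow> u x = a" and "\<And>x. 0 < x \<Longrightarrow> x < e \<Longrightarrow> u x = b"
    and "flux1 a = c" "flux1 b = c"
  shows "flux_at_0 u = c"
proof (rule flux_at_0_eq)
  have "eventually (\<lambda>x. u x = a) (at_left 0)"
    unfolding eventually_at_left_field using assms(1,2) by (intro exI[of _ "- e"]) auto
  then show "(u \<longlongrightarrow> a) (at_left 0)"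
    by (rule tendsto_eventually)
  have "eventually (\<lambda>x. u x = b) (at_right 0)"
    unfolding eventually_at_right_field using assms(1,3) by (intro exI[of _ e]) auto
  then show "(u \<longlongrightarrow> b) (at_right 0)"
    by (rule tendsto_eventually)
qed (use assms in auto)

declare RS.simps [simp del]

context aw_rascle_pressure
begin

lemma wave_speed_zero: "wave_speed p w 0 = w"
  by (simp add: wave_speed_def p_zero)

lemma wave_speed_le_velocity:
  assumes "0 \<le> \<rho>"
  shows "wave_speed p w \<rho> \<le> w - p \<rho>"
  using assms hderiv_pos[of \<rho>] by (cases "\<rho> = 0") (auto simp: wave_speed_def)

lemma RS_contact:
  assumes "0 \<le> \<rho>l"
  shows "RS p (\<rho>l, v) (\<rho>r, v) x = (if x < v then (\<rho>l, v) else (\<rho>r, v))"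
proof -
  have "\<rho>l \<in> I2 p (\<rho>l, v) v"
    using assms by (simp add: I2_def)
  from max_of_I2_eq[OF this] show ?thesis
    by (simp add: RS.simps Let_def)
qed

lemma RS_shock:
  assumes "\<rho>m \<in> I2 p (\<rho>l, vl) vr" "vr < vl"
  shows "RS p (\<rho>l, vl) (\<rho>r, vr) x =
    (if x < (\<rho>m * vr - \<rho>l * vl) / (\<rho>m - \<rho>l) then (\<rho>l, vl)
     else if x < vr then (\<rho>m, vr) else (\<rho>r, vr))"
proof -
  have "\<rho>m \<noteq> \<rho>l"
    using assms by (auto simp: I2_def)
  then show ?thesis
    using assms by (simp add: RS.simps Let_def max_of_I2_eq[OF assms(1)])
qed

lemma I2_greater:
  assumes "\<rho>m \<in> I2 p (\<rho>l, vl) vr" "vr < vl" "0 \<le> \<rho>l"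
  shows "\<rho>l < \<rho>m"
proof -
  have "p \<rho>l < p \<rho>m" "0 \<le> \<rho>m"
    using assms by (auto simp: I2_def)
  then show ?thesis
    using assms p_less_iff by blast
qed

text \<open>The density at the tail of a rarefaction: the intermediate state of velocity \<open>v\<close>, or
  the vacuum if \<open>v\<close> exceeds \<open>w\<close>.  It lets both cases share one description, because the state
  between the fan and the contact discontinuity is \<open>(a, max (w - p a) x)\<close> in either.\<close>

definition tail_density :: "real \<Rightarrow> real \<Rightarrow> real \<Rightarrow> bool" where
  "tail_density w v a \<longleftrightarrow> 0 \<le> a \<and> (if v \<le> w then w - p a = v else a = 0)"

lemma tail_density_exists:
  assumes "v \<le> w \<Longrightarrow> I2 p (\<rho>l, vl) v \<noteq> {}" "vl = w - p \<rho>l"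
  obtains a where "tail_density w v a"
proof (cases "v \<le> w")
  case True
  then show ?thesis
    using assms that by (auto simp: I2_def tail_density_def)
next
  case False
  then show ?thesis
    using that[of 0] by (simp add: tail_density_def)
qed

lemma tail_density_less:
  assumes "tail_density w vr a" "0 \<le> \<rho>l" "w - p \<rho>l < vr"
  shows "a \<le> \<rho>l"
  using assms p_less_iff[of a \<rho>l] by (auto simp: tail_density_def split: if_splits)

lemma tail_speed_le:
  assumes "tail_density w vr a"
  shows "wave_speed p w a \<le> vr" "wave_speed p w a \<le> w"
  using assms wave_speed_le_velocity[of a w] p_nonneg[of a]
  by (auto simp: tail_density_def split: if_splits)

lemma RS_rarefaction_cases:
  assumes a: "tail_density w vr a" and "0 \<le> \<rho>l" "vl = w - p \<rho>l" "vl < vr"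
  shows "RS p (\<rho>l, vl) (\<rho>r, vr) x =
    (if x < wave_speed p w \<rho>l then (\<rho>l, vl)
     else if x \<le> wave_speed p w a then fan p w a \<rho>l x
     else if x < vr then (a, max (w - p a) x)
     else (\<rho>r, vr))"
proof (cases "vr \<le> w")
  case True
  then have "a \<in> I2 p (\<rho>l, vl) vr" and va: "vr = w - p a"
    using a assms by (auto simp: I2_def tail_density_def)
  then have "max_of (I2 p (\<rho>l, vl) vr) = a"
    by (intro max_of_I2_eq)
  with True assms show ?thesis
    by (simp add: RS.simps Let_def lam1_eq_wave_speed va)
next
  case False
  then have "a = 0" "wave_speed p w a = w"
    using a by (auto simp: tail_density_def wave_speed_zero)
  with False assms show ?thesis
    by (simp add: RS.simps Let_def lam1_eq_wave_speed p_zero)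
qed

text \<open>Up to the contact discontinuity the solution is one formula built from the fan and truncations,
  hence visibly continuous; the second summand raises the velocity \<open>w\<close> at the end of the
  fan to \<open>x\<close> in the vacuum.\<close>

lemma RS_rarefaction:
  assumes a: "tail_density w vr a" and "0 \<le> \<rho>l" "vl = w - p \<rho>l" "vl < vr" "x < vr"
  shows "RS p (\<rho>l, vl) (\<rho>r, vr) x =
    fan p w a \<rho>l (max (wave_speed p w \<rho>l) (min (wave_speed p w a) x)) + (0, max 0 (x - w))"
proof -
  have "0 \<le> a" "a \<le> \<rho>l"
    using tail_density_less[OF a] a assms by (auto simp: tail_density_def)
  then have speeds: "wave_speed p w \<rho>l \<le> wave_speed p w a"
    by (simp add: wave_speed_le_iff)
  have fan_ends: "fan p w a \<rho>l (wave_speed p w \<rho>l) = (\<rho>l, vl)"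
    "fan p w a \<rho>l (wave_speed p w a) = (a, w - p a)"
    using fan_wave_speed[of a \<rho>l \<rho>l w] fan_wave_speed[of a a \<rho>l w] \<open>0 \<le> a\<close> \<open>a \<le> \<rho>l\<close> assms by auto
  note RS = RS_rarefaction_cases[OF assms(1-4), of \<rho>r x]
  note bound = tail_speed_le[OF a]
  consider "x < wave_speed p w \<rho>l" | "wave_speed p w \<rho>l \<le> x" "x \<le> wave_speed p w a"
    | "wave_speed p w a < x" by linarith
  then show ?thesis
  proof cases
    case 1
    then show ?thesis
      using RS speeds bound by (simp add: fan_ends max_absorb1 min_absorb2)
  next
    case 2
    then show ?thesis
      using RS speeds bound by (simp add: max_absorb1 max_absorb2 min_absorb2 flip: zero_prod_def)
  next
    case 3
    have "(a, max (w - p a) x) = (a, w - p a) + (0, max 0 (x - w))"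
      using a \<open>x < vr\<close> by (auto simp: tail_density_def p_zero max_def split: if_splits)
    then show ?thesis
      using RS speeds bound 3 \<open>x < vr\<close> by (simp add: fan_ends max_absorb2 min_absorb1)
  qed
qed

lemma RS_after_contact:
  assumes "vr \<le> w \<Longrightarrow> I2 p (\<rho>l, vl) vr \<noteq> {}" "0 \<le> \<rho>l" "vl = w - p \<rho>l" "vr < x"
  shows "RS p (\<rho>l, vl) (\<rho>r, vr) x = (\<rho>r, vr)"
proof -
  consider "vr < vl" | "vr = vl" | "vl < vr" by linarith
  then show ?thesis
  proof cases
    case 1
    then have "vr \<le> w"
      using assms p_nonneg[of \<rho>l] by simp
    then obtain \<rho>m where \<rho>m: "\<rho>m \<in> I2 p (\<rho>l, vl) vr"
      using assms by blast
    have "\<rho>l < \<rho>m"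
      using I2_greater[OF \<rho>m 1] assms by simp
    moreover have "\<rho>l * vr \<le> \<rho>l * vl"
      using 1 assms by (simp add: mult_left_mono)
    ultimately have "(\<rho>m * vr - \<rho>l * vl) / (\<rho>m - \<rho>l) \<le> vr"
      by (simp add: divide_le_eq algebra_simps)
    then show ?thesis
      using RS_shock[OF \<rho>m 1] assms by simp
  next
    case 2
    then show ?thesis
      using RS_contact assms by simp
  next
    case 3
    obtain a where a: "tail_density w vr a"
      using tail_density_exists[OF assms(1,3)] by blast
    have "wave_speed p w \<rho>l \<le> vr"
      using wave_speed_le_velocity[of \<rho>l w] assms 3 by simp
    then show ?thesis
      using RS_rarefaction_cases[OF a _ _ 3, of \<rho>l \<rho>r x] tail_speed_le[OF a] assms by simp
  qed
qed

text \<open>The flux decreases, in the direction of increasing \<open>x\<close>, across a shock of negative speed and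
  increases across one of positive speed; so the trace at the origin always carries the smaller of
  the two fluxes.\<close>

lemma flux_at_0_shock_le:
  assumes \<rho>m: "\<rho>m \<in> I2 p (\<rho>l, vl) vr" and "vr \<le> vl" "0 \<le> \<rho>l" "0 \<le> vr"
  shows "flux_at_0 (RS p (\<rho>l, vl) (\<rho>r, vr)) \<le> \<rho>m * vr"
proof (cases "vr = vl")
  case True
  then have "\<rho>m = \<rho>l"
    using \<rho>m assms p_eq_iff[of \<rho>m \<rho>l] by (simp add: I2_def)
  define e where "e = (if vr = 0 then 1 else vr)"
  have "flux_at_0 (RS p (\<rho>l, vl) (\<rho>r, vr)) = \<rho>m * vr"
    by (rule flux_at_0_jump[of e _ "(\<rho>l, vr)" "if vr = 0 then (\<rho>r, vr) else (\<rho>l, vr)"])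
       (use assms True \<open>\<rho>m = \<rho>l\<close> RS_contact[of \<rho>l] in \<open>auto simp: e_def flux1_def\<close>)
  then show ?thesis by simp
next
  case False
  then have "vr < vl"
    using assms by simp
  have "\<rho>l < \<rho>m"
    by (rule I2_greater[OF \<rho>m \<open>vr < vl\<close> \<open>0 \<le> \<rho>l\<close>])
  define \<sigma> where "\<sigma> = (\<rho>m * vr - \<rho>l * vl) / (\<rho>m - \<rho>l)"
  have RS: "RS p (\<rho>l, vl) (\<rho>r, vr) x =
    (if x < \<sigma> then (\<rho>l, vl) else if x < vr then (\<rho>m, vr) else (\<rho>r, vr))" for x
    unfolding \<sigma>_def by (rule RS_shock[OF \<rho>m \<open>vr < vl\<close>])
  have jump: "\<rho>m * vr - \<rho>l * vl = \<sigma> * (\<rho>m - \<rho>l)"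
    using \<open>\<rho>l < \<rho>m\<close> by (simp add: \<sigma>_def)
  \<comment> \<open>The right trace at the origin if \<open>\<sigma> \<le> 0\<close>.  If \<open>vr = 0\<close> it is the right datum, with flux zero.\<close>
  define b where "b = (if vr = 0 then (\<rho>r, vr) else (\<rho>m, vr))"
  have b: "flux1 b = \<rho>m * vr"
    by (auto simp: b_def flux1_def)
  define e where "e = (if vr = 0 then 1 else vr)"
  have e: "0 < e"
    using assms by (simp add: e_def)
  show ?thesis
  proof (cases \<sigma> "0 :: real" rule: linorder_cases)
    case less
    have "flux_at_0 (RS p (\<rho>l, vl) (\<rho>r, vr)) = \<rho>m * vr"
      by (rule flux_at_0_jump[of "min (- \<sigma>) e" _ "(\<rho>m, vr)" b])
         (use less e assms b in \<open>auto simp: RS b_def e_def flux1_def split: if_splits\<close>)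
    then show ?thesis by simp
  next
    case equal
    then have "\<rho>l * vl = \<rho>m * vr"
      using jump by simp
    then have "flux_at_0 (RS p (\<rho>l, vl) (\<rho>r, vr)) = \<rho>m * vr"
      by (intro flux_at_0_jump[of e _ "(\<rho>l, vl)" b])
         (use equal e assms b in \<open>auto simp: RS b_def e_def flux1_def split: if_splits\<close>)
    then show ?thesis by simp
  next
    case greater
    then have "flux_at_0 (RS p (\<rho>l, vl) (\<rho>r, vr)) = \<rho>l * vl"
      by (intro flux_at_0_jump[of \<sigma> _ "(\<rho>l, vl)" "(\<rho>l, vl)"]) (auto simp: RS flux1_def)
    moreover have "0 < \<sigma> * (\<rho>m - \<rho>l)"
      using greater \<open>\<rho>l < \<rho>m\<close> by simp
    ultimately show ?thesis
      using jump by simp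
  qed
qed

text \<open>The solution is continuous for \<open>x < vr\<close>, thus at the origin, and there it is a state of the
  fan or one of its end states; vacuum cannot give another state, as it appears for \<open>x > w \<ge> 0\<close>
  only.\<close>

lemma flux_at_0_rarefaction:
  assumes a: "tail_density w vr a" and "0 \<le> \<rho>l" "vl = w - p \<rho>l" "vl < vr" "0 \<le> vl"
  obtains \<rho>0 where "a \<le> \<rho>0" "\<rho>0 \<le> \<rho>l" "flux_at_0 (RS p (\<rho>l, vl) (\<rho>r, vr)) = wave_flux p w \<rho>0"
proof -
  have "0 \<le> a" "a \<le> \<rho>l"
    using tail_density_less[OF a] a assms by (auto simp: tail_density_def)
  then have speeds: "wave_speed p w \<rho>l \<le> wave_speed p w a"
    by (simp add: wave_speed_le_iff)
  let ?cl = "\<lambda>x. max (wave_speed p w \<rho>l) (min (wave_speed p w a) x)"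
  let ?G = "\<lambda>x. fan p w a \<rho>l (?cl x) + (0, max 0 (x - w))"
  obtain \<rho>0 where \<rho>0: "a \<le> \<rho>0" "\<rho>0 \<le> \<rho>l" "wave_speed p w \<rho>0 = ?cl 0"
    by (rule wave_speed_surj[OF \<open>0 \<le> a\<close> \<open>a \<le> \<rho>l\<close>, of w "?cl 0"]) (use speeds in auto)
  have "continuous_on UNIV (\<lambda>x. fan p w a \<rho>l (?cl x))"
    by (rule continuous_on_compose2[OF continuous_on_fan[OF \<open>0 \<le> a\<close> \<open>a \<le> \<rho>l\<close>]])
       (use speeds in \<open>auto intro!: continuous_intros\<close>)
  then have "continuous_on UNIV ?G"
    by (intro continuous_intros)
  then have "isCont ?G 0"
    by (rule continuous_on_interior) simp
  then have G: "(?G \<longlongrightarrow> ?G 0) (at 0)"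
    unfolding isCont_def .
  have "0 < vr"
    using assms by simp
  have eq: "RS p (\<rho>l, vl) (\<rho>r, vr) x = ?G x" if "x < vr" for x
    using RS_rarefaction[OF assms(1-4) that] .
  have "eventually (\<lambda>x. ?G x = RS p (\<rho>l, vl) (\<rho>r, vr) x) (at 0)"
    using order_tendstoD(2)[OF tendsto_ident_at \<open>0 < vr\<close>, of UNIV]
    by eventually_elim (simp add: eq)
  then have lim: "(RS p (\<rho>l, vl) (\<rho>r, vr) \<longlongrightarrow> ?G 0) (at 0)"
    by (rule Lim_transform_eventually[OF G])
  have "0 \<le> w"
    using assms p_nonneg[of \<rho>l] by simp
  then have "?G 0 = (\<rho>0, w - p \<rho>0)"
    using fan_wave_speed[OF \<open>0 \<le> a\<close> \<rho>0(1,2), of w] \<rho>0(3) by (simp add: max_absorb1)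
  then have "flux1 (?G 0) = wave_flux p w \<rho>0"
    by (simp add: flux1_def wave_flux_def)
  then have "flux_at_0 (RS p (\<rho>l, vl) (\<rho>r, vr)) = wave_flux p w \<rho>0"
    using lim by (intro flux_at_0_eq[of _ "?G 0" "?G 0"]) (auto intro: tendsto_within_subset)
  then show ?thesis
    using that \<rho>0 by blast
qed

text \<open>For a shock \<open>\<rho>0\<close> is the intermediate density itself, for a rarefaction the density at the
  origin, which is at least that at the tail.\<close>

lemma flux_at_0_exceeds:
  assumes "0 \<le> \<rho>l" "0 \<le> vl" "0 \<le> vr" "w = vl + p \<rho>l"
    and "vr \<le> w \<Longrightarrow> I2 p (\<rho>l, vl) vr \<noteq> {}"
    and "0 \<le> q" "q < flux_at_0 (RS p (\<rho>l, vl) (\<rho>r, vr))"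
  obtains \<rho>0 where "0 < vr" "0 \<le> \<rho>0" "q < wave_flux p w \<rho>0"
    "\<And>\<rho>m. \<rho>m \<in> I2 p (\<rho>l, vl) vr \<Longrightarrow> \<rho>m \<le> \<rho>0"
proof (cases "vr \<le> vl")
  case True
  then have "vr \<le> w"
    using assms p_nonneg[of \<rho>l] by simp
  then obtain \<rho>m where \<rho>m: "\<rho>m \<in> I2 p (\<rho>l, vl) vr"
    using assms by blast
  then have "q < \<rho>m * vr"
    using flux_at_0_shock_le[OF \<rho>m True assms(1,3), of \<rho>r] assms(7) by linarith
  moreover have "0 \<le> \<rho>m" "wave_flux p w \<rho>m = \<rho>m * vr"
    using \<rho>m assms by (auto simp: I2_def wave_flux_def)
  moreover have "\<rho>' = \<rho>m" if "\<rho>' \<in> I2 p (\<rho>l, vl) vr" for \<rho>'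
    using max_of_I2_eq[OF \<rho>m] max_of_I2_eq[OF that] by simp
  moreover have "0 < vr"
    using \<open>q < \<rho>m * vr\<close> assms by (cases "vr = 0") auto
  ultimately show ?thesis
    using that[of \<rho>m] by auto
next
  case False
  then have "vl < vr" by simp
  have vl: "vl = w - p \<rho>l"
    using assms by simp
  obtain a where a: "tail_density w vr a"
    using tail_density_exists[OF assms(5) vl] by blast
  obtain \<rho>0 where \<rho>0: "a \<le> \<rho>0" "flux_at_0 (RS p (\<rho>l, vl) (\<rho>r, vr)) = wave_flux p w \<rho>0"
    using flux_at_0_rarefaction[OF a assms(1) vl \<open>vl < vr\<close> assms(2), of \<rho>r] by blast
  have "\<rho>m \<le> \<rho>0" if "\<rho>m \<in> I2 p (\<rho>l, vl) vr" for \<rho>m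
  proof -
    have \<rho>m: "0 \<le> \<rho>m" "w - p \<rho>m = vr"
      using that assms by (auto simp: I2_def)
    then have "vr \<le> w"
      using p_nonneg[of \<rho>m] by simp
    then have "0 \<le> a" "p \<rho>m = p a"
      using a \<rho>m by (auto simp: tail_density_def)
    then show ?thesis
      using \<rho>m \<rho>0 p_eq_iff[of \<rho>m a] by simp
  qed
  moreover have "0 \<le> \<rho>0" "0 < vr"
    using a \<rho>0 \<open>vl < vr\<close> assms by (auto simp: tail_density_def)
  ultimately show ?thesis
    using that[of \<rho>0] \<rho>0 assms(7) by simp
qed

end

section \<open>The constrained solutions\<close>

lemma y_of_wave_curve: "y_of p (\<rho>, w - p \<rho>) = \<rho> * w"
  by (simp add: y_of_def)

context aw_rascle_pressure
begin

lemma y_of_mono: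
  assumes "0 \<le> a" "a \<le> b" "0 \<le> v"
  shows "y_of p (a, v) \<le> y_of p (b, v)"
  using assms p_nonneg[of a] p_le_iff[of a b] by (auto simp: y_of_def intro!: mult_mono)

lemma y_of_strict_mono:
  assumes "0 \<le> a" "a < b" "0 < v"
  shows "y_of p (a, v) < y_of p (b, v)"
  using assms p_nonneg[of a] p_strict_mono[of a b]
  by (auto simp: y_of_def intro!: mult_strict_mono add_strict_left_mono)

text \<open>At flux \<open>q\<close> the quantity \<open>y\<close> is \<open>q + \<rho> * p \<rho>\<close>.\<close>

lemma y_of_fixed_flux_strict_mono:
  assumes "0 \<le> a" "a < b" "a * v = q" "b * v' = q"
  shows "y_of p (a, v) < y_of p (b, v')"
proof -
  have "a * p a < b * p b"
    using assms p_nonneg[of a] p_strict_mono[of a b] by (intro mult_strict_mono) auto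
  then show ?thesis
    using assms by (simp add: y_of_def distrib_left)
qed

text \<open>The flux is at most \<open>q\<close> at density \<open>0\<close> and exceeds it at \<open>\<rho>0\<close>, so there is a smallest root
  below \<open>\<rho>0\<close>.  The tangent there must rise, as it stays above the flux at \<open>\<rho>0\<close>.\<close>

lemma check1_root:
  assumes "0 < q" "w = snd ul + p (fst ul)" "0 \<le> \<rho>0" "q < wave_flux p w \<rho>0"
  obtains \<rho>1 where "check1 p q ul = (\<rho>1, w - p \<rho>1)" "0 < \<rho>1" "\<rho>1 < \<rho>0"
    "wave_flux p w \<rho>1 = q" "0 < wave_speed p w \<rho>1"
proof -
  let ?S = "{0..\<rho>0} \<inter> wave_flux p w -` {q}"
  have cont: "continuous_on {0..\<rho>0} (wave_flux p w)"
    by (rule continuous_on_subset[OF continuous_on_wave_flux]) auto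
  have "wave_flux p w 0 \<le> q"
    using assms(1) by (simp add: wave_flux_def)
  then have "?S \<noteq> {}"
    using IVT'[of "wave_flux p w" 0 q \<rho>0] assms cont by fastforce
  moreover have "compact ?S"
    using continuous_closed_preimage[OF cont, of "{q}"]
    by (simp add: compact_eq_bounded_closed bounded_Int)
  ultimately obtain \<rho>1 where "\<rho>1 \<in> ?S" and least: "\<And>\<rho>. \<rho> \<in> ?S \<Longrightarrow> \<rho>1 \<le> \<rho>"
    using compact_attains_inf[of ?S] by blast
  then have \<rho>1: "0 \<le> \<rho>1" "\<rho>1 \<le> \<rho>0" "wave_flux p w \<rho>1 = q"
    by auto
  have "\<rho>1 \<noteq> 0" "\<rho>1 \<noteq> \<rho>0"
    using \<rho>1 assms by (auto simp: wave_flux_def)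
  with \<rho>1 have pos: "0 < \<rho>1" "\<rho>1 < \<rho>0"
    by auto
  have I1: "I1 p q ul = {\<rho>. 0 \<le> \<rho> \<and> wave_flux p w \<rho> = q}"
    using assms by (simp add: I1_def wave_flux_def)
  have "min_of (I1 p q ul) = \<rho>1"
    unfolding min_of_def
  proof (rule Least_equality)
    show "\<rho>1 \<in> I1 p q ul"
      using \<rho>1 I1 by simp
    show "\<rho>1 \<le> \<rho>" if "\<rho> \<in> I1 p q ul" for \<rho>
      using that least[of \<rho>] \<rho>1(2) unfolding I1 by (cases "\<rho> \<le> \<rho>0") auto
  qed
  moreover have "q / \<rho>1 = w - p \<rho>1"
    using \<rho>1(3) pos by (auto simp: wave_flux_def)
  ultimately have "check1 p q ul = (\<rho>1, w - p \<rho>1)"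
    by (simp add: check1_def Let_def)
  moreover have "0 < wave_speed p w \<rho>1 * (\<rho>0 - \<rho>1)"
    using wave_flux_below_tangent[OF pos(1), of \<rho>0 w] \<rho>1 assms by simp
  then have "0 < wave_speed p w \<rho>1"
    by (rule zero_less_mult_pos2) (use pos in simp)
  ultimately show ?thesis
    using that pos \<rho>1 by blast
qed

text \<open>A shock of positive speed leaves room for both of its states in \<open>0 < x < vr\<close>, and their
  values of \<open>y\<close> enclose that of \<open>(q / vr, vr)\<close>.\<close>

lemma shock_detour:
  assumes "0 < \<rho>1" "wave_flux p w \<rho>1 = q" "0 < q" "0 < vr" "vr < w - p \<rho>1"
    and \<rho>m: "\<rho>m \<in> I2 p (\<rho>1, w - p \<rho>1) vr" "q \<le> \<rho>m * vr"
  obtains \<alpha> \<beta> \<gamma> \<delta> where "0 \<le> \<alpha>" "\<alpha> < \<beta>" "\<beta> \<le> \<gamma>" "\<gamma> < \<delta>" "\<delta> \<le> vr"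
    "\<And>x x'. \<alpha> < x \<Longrightarrow> x < \<beta> \<Longrightarrow> \<gamma> < x' \<Longrightarrow> x' < \<delta> \<Longrightarrow>
       y_of p (RS p (\<rho>1, w - p \<rho>1) (\<rho>r, vr) x) \<le> y_of p (q / vr, vr) \<and>
       y_of p (q / vr, vr) \<le> y_of p (RS p (\<rho>1, w - p \<rho>1) (\<rho>r, vr) x')"
proof -
  let ?v1 = "w - p \<rho>1"
  have "\<rho>1 < \<rho>m"
    using I2_greater[OF \<rho>m(1)] assms by simp
  have q: "\<rho>1 * ?v1 = q"
    using assms by (simp add: wave_flux_def)
  define \<sigma> where "\<sigma> = (\<rho>m * vr - \<rho>1 * ?v1) / (\<rho>m - \<rho>1)"
  have RS: "RS p (\<rho>1, ?v1) (\<rho>r, vr) x =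
    (if x < \<sigma> then (\<rho>1, ?v1) else if x < vr then (\<rho>m, vr) else (\<rho>r, vr))" for x
    unfolding \<sigma>_def by (rule RS_shock[OF \<rho>m(1)]) (use assms in simp)
  have "\<rho>1 * vr < q"
    using mult_strict_left_mono[OF assms(5,1)] q by simp
  then have "\<sigma> < vr"
    using \<open>\<rho>1 < \<rho>m\<close> unfolding \<sigma>_def q by (simp add: divide_less_eq algebra_simps)
  have "\<rho>1 < q / vr" "q / vr \<le> \<rho>m"
    using \<open>\<rho>1 * vr < q\<close> \<rho>m assms by (simp_all add: field_simps)
  have y1: "y_of p (\<rho>1, ?v1) < y_of p (q / vr, vr)"
    by (rule y_of_fixed_flux_strict_mono[of _ _ _ q]) (use \<open>\<rho>1 < q / vr\<close> assms q in auto)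
  have ym: "y_of p (q / vr, vr) \<le> y_of p (\<rho>m, vr)"
    by (rule y_of_mono) (use \<open>q / vr \<le> \<rho>m\<close> assms in auto)
  show ?thesis
  proof (cases "0 < \<sigma>")
    case True
    show ?thesis
      by (rule that[of 0 \<sigma> \<sigma> vr]) (use True \<open>\<sigma> < vr\<close> y1 ym in \<open>auto simp: RS\<close>)
  next
    \<comment> \<open>A shock at rest, with \<open>\<rho>m * vr = q\<close>: the state behind it has density \<open>q / vr\<close>.\<close>
    case False
    then have "\<rho>m * vr \<le> q"
      using \<open>\<rho>1 < \<rho>m\<close> unfolding \<sigma>_def q by (simp add: zero_less_divide_iff)
    then have "\<rho>m = q / vr"
      using \<rho>m assms by (simp add: field_simps)
    then show ?thesis
      using False assms by (intro that[of 0 "vr / 2" "vr / 2" vr]) (auto simp: RS)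
  qed
qed

text \<open>The state \<open>\<rho>1\<close> occupies an interval after the origin because its speed is positive.  The tail
  state need not occupy an interval: if \<open>vr = w\<close> it is the vacuum, reached only at the end of the
  fan.  Hence the second interval is a part of the fan that is close enough to its tail.\<close>

lemma rarefaction_detour:
  assumes "0 < \<rho>1" "wave_flux p w \<rho>1 = q" "0 < q" "0 < wave_speed p w \<rho>1" "w - p \<rho>1 < vr"
    and a: "tail_density w vr a"
  obtains \<alpha> \<beta> \<gamma> \<delta> where "0 \<le> \<alpha>" "\<alpha> < \<beta>" "\<beta> \<le> \<gamma>" "\<gamma> < \<delta>" "\<delta> \<le> vr"
    "\<And>x x'. \<alpha> < x \<Longrightarrow> x < \<beta> \<Longrightarrow> \<gamma> < x' \<Longrightarrow> x' < \<delta> \<Longrightarrow>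
       y_of p (RS p (\<rho>1, w - p \<rho>1) (\<rho>r, vr) x') \<le> y_of p (q / vr, vr) \<and>
       y_of p (q / vr, vr) \<le> y_of p (RS p (\<rho>1, w - p \<rho>1) (\<rho>r, vr) x)"
proof -
  let ?v1 = "w - p \<rho>1" and ?c = "y_of p (q / vr, vr)"
  have q: "\<rho>1 * ?v1 = q"
    using assms by (simp add: wave_flux_def)
  then have "0 < ?v1"
    using assms by (metis zero_less_mult_pos)
  then have "0 < w" "0 < vr"
    using assms p_nonneg[of \<rho>1] by auto
  have "0 \<le> a" "a \<le> \<rho>1"
    using tail_density_less[OF a] a assms by (auto simp: tail_density_def)
  have "a \<noteq> \<rho>1"
    using a assms by (auto simp: tail_density_def split: if_splits)
  with \<open>a \<le> \<rho>1\<close> have "a < \<rho>1" by simp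
  have "\<rho>1 * ?v1 < \<rho>1 * vr"
    by (rule mult_strict_left_mono) (use assms in auto)
  then have "q / vr < \<rho>1"
    using q \<open>0 < vr\<close> by (simp add: field_simps)
  then have "?c < y_of p (\<rho>1, ?v1)"
    using \<open>0 < vr\<close> \<open>0 < q\<close> q by (intro y_of_fixed_flux_strict_mono[of _ _ _ q]) auto
  then have c_less: "?c < \<rho>1 * w"
    by (simp only: y_of_wave_curve)
  have c_gr: "a * w < ?c"
  proof (cases "vr \<le> w")
    case True
    then have va: "w - p a = vr"
      using a by (simp add: tail_density_def)
    have "wave_speed p w \<rho>1 * (a - \<rho>1) < 0"
      using assms \<open>a < \<rho>1\<close> by (intro mult_pos_neg) auto
    then have "wave_flux p w a < q"
      using wave_flux_below_tangent[OF \<open>0 < \<rho>1\<close> \<open>0 \<le> a\<close>, of w] assms(2) by linarith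
    then have "a < q / vr"
      using va \<open>0 < vr\<close> by (simp add: wave_flux_def field_simps)
    then have "y_of p (a, vr) < ?c"
      using \<open>0 \<le> a\<close> \<open>0 < vr\<close> by (intro y_of_strict_mono)
    then show ?thesis
      using va y_of_wave_curve[of p a w] by simp
  next
    case False
    then have "a = 0"
      using a by (simp add: tail_density_def)
    moreover have "y_of p (0, vr) < ?c"
      using \<open>0 < vr\<close> \<open>0 < q\<close> by (intro y_of_strict_mono) auto
    ultimately show ?thesis
      by (simp add: y_of_def)
  qed
  \<comment> \<open>The density in the rarefaction fan at which \<open>y\<close> takes the value \<open>?c\<close>.\<close>
  define \<rho>c where "\<rho>c = ?c / w"
  have "a < \<rho>c" "\<rho>c < \<rho>1" "\<rho>c * w = ?c"
    using c_less c_gr \<open>0 < w\<close> by (simp_all add: \<rho>c_def field_simps)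
  have speeds: "wave_speed p w \<rho>1 < wave_speed p w \<rho>c" "wave_speed p w \<rho>c < wave_speed p w a"
    using \<open>a < \<rho>c\<close> \<open>\<rho>c < \<rho>1\<close> \<open>0 \<le> a\<close> by (auto intro!: wave_speed_strict_antimono)
  have y: "y_of p (RS p (\<rho>1, ?v1) (\<rho>r, vr) (wave_speed p w \<rho>)) = \<rho> * w"
    if "a < \<rho>" "\<rho> \<le> \<rho>1" for \<rho>
  proof -
    have "wave_speed p w \<rho> < wave_speed p w a" "wave_speed p w \<rho>1 \<le> wave_speed p w \<rho>"
      using that \<open>0 \<le> a\<close> by (auto simp: wave_speed_le_iff intro!: wave_speed_strict_antimono)
    then have "RS p (\<rho>1, ?v1) (\<rho>r, vr) (wave_speed p w \<rho>) = fan p w a \<rho>1 (wave_speed p w \<rho>)"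
      using RS_rarefaction_cases[OF a _ _ \<open>?v1 < vr\<close>] \<open>0 < \<rho>1\<close> by simp
    then show ?thesis
      using fan_wave_speed[of a \<rho> \<rho>1 w] that \<open>0 \<le> a\<close> by (simp add: y_of_wave_curve)
  qed
  show ?thesis
  proof (rule that[of 0 "wave_speed p w \<rho>1" "wave_speed p w \<rho>c" "wave_speed p w a"])
    fix x x' assume x: "x < wave_speed p w \<rho>1" and x': "wave_speed p w \<rho>c < x'" "x' < wave_speed p w a"
    have "RS p (\<rho>1, ?v1) (\<rho>r, vr) x = (\<rho>1, ?v1)"
      using RS_rarefaction_cases[OF a _ _ \<open>?v1 < vr\<close>] \<open>0 < \<rho>1\<close> x by simp
    then have "?c \<le> y_of p (RS p (\<rho>1, ?v1) (\<rho>r, vr) x)"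
      using c_less by (simp add: y_of_wave_curve)
    moreover obtain \<rho> where \<rho>: "a \<le> \<rho>" "\<rho> \<le> \<rho>c" "wave_speed p w \<rho> = x'"
      by (rule wave_speed_surj[of a \<rho>c w x']) (use x' \<open>0 \<le> a\<close> \<open>a < \<rho>c\<close> in auto)
    have "\<rho> * w \<le> ?c"
      using \<rho> \<open>0 < w\<close> \<open>\<rho>c * w = ?c\<close> by (metis mult_right_mono less_imp_le)
    moreover have "a < \<rho>"
      using \<rho> x' by (cases "a = \<rho>") auto
    ultimately show "y_of p (RS p (\<rho>1, ?v1) (\<rho>r, vr) x') \<le> ?c \<and>
        ?c \<le> y_of p (RS p (\<rho>1, ?v1) (\<rho>r, vr) x)"
      using y[of \<rho>] \<rho> \<open>\<rho>c < \<rho>1\<close> by simp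
  qed (use speeds assms tail_speed_le[OF a] in auto)
qed

text \<open>The right-hand part of the first constrained solution, for all positions of \<open>vr\<close> relative
  to the velocity of \<open>\<rho>1\<close>; if they are equal, both constrained solutions coincide there.\<close>

lemma check1_detour:
  assumes "0 < \<rho>1" "wave_flux p w \<rho>1 = q" "0 < q" "0 < wave_speed p w \<rho>1" "0 < vr"
    and I2: "vr \<le> w \<Longrightarrow> I2 p (\<rho>1, w - p \<rho>1) vr \<noteq> {}"
    and demand: "\<And>\<rho>m. \<rho>m \<in> I2 p (\<rho>1, w - p \<rho>1) vr \<Longrightarrow> \<rho>1 \<le> \<rho>m \<Longrightarrow> q \<le> \<rho>m * vr"
  obtains \<alpha> \<beta> \<gamma> \<delta> where "0 \<le> \<alpha>" "\<alpha> < \<beta>" "\<beta> \<le> \<gamma>" "\<gamma> < \<delta>" "\<delta> \<le> vr"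
    "\<And>x x'. \<alpha> < x \<Longrightarrow> x < \<beta> \<Longrightarrow> \<gamma> < x' \<Longrightarrow> x' < \<delta> \<Longrightarrow>
       min (y_of p (RS p (\<rho>1, w - p \<rho>1) (\<rho>r, vr) x)) (y_of p (RS p (\<rho>1, w - p \<rho>1) (\<rho>r, vr) x'))
         \<le> y_of p (q / vr, vr) \<and>
       y_of p (q / vr, vr)
         \<le> max (y_of p (RS p (\<rho>1, w - p \<rho>1) (\<rho>r, vr) x)) (y_of p (RS p (\<rho>1, w - p \<rho>1) (\<rho>r, vr) x'))"
proof -
  let ?v1 = "w - p \<rho>1"
  consider "vr < ?v1" | "vr = ?v1" | "?v1 < vr" by linarith
  then show ?thesis
  proof cases
    case 1
    then have "vr \<le> w"
      using p_nonneg[of \<rho>1] assms by simp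
    then obtain \<rho>m where \<rho>m: "\<rho>m \<in> I2 p (\<rho>1, ?v1) vr"
      using I2 by blast
    have "q \<le> \<rho>m * vr"
      using demand[OF \<rho>m] I2_greater[OF \<rho>m 1] assms by simp
    show ?thesis
      by (rule shock_detour[OF assms(1-3,5) 1 \<rho>m \<open>q \<le> \<rho>m * vr\<close>, of \<rho>r], rule that,
          unfold min_le_iff_disj le_max_iff_disj) blast+
  next
    case 2
    have "q / vr = \<rho>1"
      using assms 2 by (auto simp: wave_flux_def)
    then show ?thesis
      using assms 2 RS_contact[of \<rho>1 vr \<rho>r]
      by (intro that[of 0 "vr / 2" "vr / 2" vr]) auto
  next
    case 3
    obtain a where a: "tail_density w vr a"
      using tail_density_exists[OF I2 refl] by blast
    show ?thesis
      by (rule rarefaction_detour[OF assms(1-4) 3 a, of \<rho>r], rule that,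
          unfold min_le_iff_disj le_max_iff_disj) blast+
  qed
qed

end

theorem proposition4p3:
  fixes p :: "real \<Rightarrow> real" and q \<rho>l vl \<rho>r vr :: real
  assumes "pressure p" and "q > 0"
    and "(\<rho>l, vl) \<in> states" and "(\<rho>r, vr) \<in> states"
    and RS_defined: "vr \<le> vl + p \<rho>l \<Longrightarrow> I2 p (\<rho>l, vl) vr \<noteq> {}"
  shows "total_variation (\<lambda>x. y_of p (RSq1 p q (\<rho>l, vl) (\<rho>r, vr) x))
       \<ge> total_variation (\<lambda>x. y_of p (RSq2 p q (\<rho>l, vl) (\<rho>r, vr) x))"
proof (cases "flux_at_0 (RS p (\<rho>l, vl) (\<rho>r, vr)) \<le> q")
  case True
  then show ?thesis
    by (simp add: RSq1_def RSq2_def constrained_def)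
next
  case False
  interpret aw_rascle_pressure p
    by unfold_locales (rule assms(1))
  define w where "w = vl + p \<rho>l"
  have nonneg: "0 \<le> \<rho>l" "0 \<le> vl" "0 \<le> vr"
    using assms by (auto simp: states_def)
  obtain \<rho>0 where "0 < vr" "0 \<le> \<rho>0" and \<rho>0: "q < wave_flux p w \<rho>0"
    and \<rho>m_le: "\<And>\<rho>m. \<rho>m \<in> I2 p (\<rho>l, vl) vr \<Longrightarrow> \<rho>m \<le> \<rho>0"
    by (rule flux_at_0_exceeds[OF nonneg w_def, of q \<rho>r])
       (use RS_defined False \<open>q > 0\<close> in \<open>auto simp: w_def\<close>)
  obtain \<rho>1 where chk: "check1 p q (\<rho>l, vl) = (\<rho>1, w - p \<rho>1)" and "0 < \<rho>1" "\<rho>1 < \<rho>0"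
    and \<rho>1: "wave_flux p w \<rho>1 = q" "0 < wave_speed p w \<rho>1"
    by (rule check1_root[OF \<open>q > 0\<close> _ \<open>0 \<le> \<rho>0\<close> \<rho>0, of "(\<rho>l, vl)"]) (simp add: w_def)
  have I2_eq: "I2 p (\<rho>1, w - p \<rho>1) vr = I2 p (\<rho>l, vl) vr"
    by (simp add: I2_def w_def)
  have I2: "I2 p (\<rho>1, w - p \<rho>1) vr \<noteq> {}" if "vr \<le> w"
    unfolding I2_eq by (rule RS_defined) (use that in \<open>simp add: w_def\<close>)
  have demand: "q \<le> \<rho>m * vr" if \<rho>m: "\<rho>m \<in> I2 p (\<rho>1, w - p \<rho>1) vr" and "\<rho>1 \<le> \<rho>m" for \<rho>m
  proof -
    have "\<rho>m \<le> \<rho>0"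
      using \<rho>m_le \<rho>m by (simp add: I2_eq)
    then have "q \<le> wave_flux p w \<rho>m"
      using wave_flux_ge_between[of \<rho>m \<rho>1 \<rho>0 q w] \<open>0 < \<rho>1\<close> \<open>\<rho>1 \<le> \<rho>m\<close> \<rho>0 \<rho>1 by simp
    then show ?thesis
      using \<rho>m by (simp add: I2_def wave_flux_def)
  qed
  let ?y1 = "\<lambda>x. y_of p (RSq1 p q (\<rho>l, vl) (\<rho>r, vr) x)"
  let ?y2 = "\<lambda>x. y_of p (RSq2 p q (\<rho>l, vl) (\<rho>r, vr) x)"
  have y1: "?y1 x = y_of p (RS p (\<rho>1, w - p \<rho>1) (\<rho>r, vr) x)" if "0 \<le> x" for x
    using False that by (simp add: RSq1_def constrained_def chk)
  have RSq2: "RSq2 p q (\<rho>l, vl) (\<rho>r, vr) x = (if x < vr then (q / vr, vr) else (\<rho>r, vr))"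
    if "0 \<le> x" for x
    using False that \<open>0 < vr\<close> \<open>q > 0\<close> RS_contact[of "q / vr" vr \<rho>r x]
    by (simp add: RSq2_def constrained_def check2_def)
  obtain \<alpha> \<beta> \<gamma> \<delta> where ord: "0 \<le> \<alpha>" "\<alpha> < \<beta>" "\<beta> \<le> \<gamma>" "\<gamma> < \<delta>" "\<delta> \<le> vr"
    and between: "\<And>x x'. \<alpha> < x \<Longrightarrow> x < \<beta> \<Longrightarrow> \<gamma> < x' \<Longrightarrow> x' < \<delta> \<Longrightarrow>
       min (y_of p (RS p (\<rho>1, w - p \<rho>1) (\<rho>r, vr) x)) (y_of p (RS p (\<rho>1, w - p \<rho>1) (\<rho>r, vr) x'))
         \<le> y_of p (q / vr, vr) \<and>
       y_of p (q / vr, vr)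
         \<le> max (y_of p (RS p (\<rho>1, w - p \<rho>1) (\<rho>r, vr) x)) (y_of p (RS p (\<rho>1, w - p \<rho>1) (\<rho>r, vr) x'))"
    using check1_detour[OF \<open>0 < \<rho>1\<close> \<rho>1(1) \<open>q > 0\<close> \<rho>1(2) \<open>0 < vr\<close> I2 demand, of \<rho>r] by blast
  show ?thesis
  proof (rule total_variation_le_of_detour[OF _ _ _ _ ord])
    show "?y2 x = ?y1 x" if "x < 0" for x
      using False that by (simp add: RSq1_def RSq2_def constrained_def)
    show "?y2 x = y_of p (q / vr, vr)" if "0 \<le> x" "x < vr" for x
      using RSq2 that by simp
    show "?y2 x = y_of p (\<rho>r, vr)" if "vr \<le> x" for x
      using RSq2 that \<open>0 < vr\<close> by simp
    show "?y1 x = y_of p (\<rho>r, vr)" if "vr < x" for x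
      using y1 that \<open>0 < vr\<close> RS_after_contact[OF I2 _ refl that, of \<rho>r] \<open>0 < \<rho>1\<close> by simp
    show "min (?y1 x) (?y1 x') \<le> y_of p (q / vr, vr) \<and> y_of p (q / vr, vr) \<le> max (?y1 x) (?y1 x')"
      if "\<alpha> < x" "x < \<beta>" "\<gamma> < x'" "x' < \<delta>" for x x'
      using between[OF that] y1 ord that by simp
  qed
qed

end
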